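(* Let $1\le q\le2$, $\alpha>\beta>0$, $\beta=\eta\alpha$, $\delta>0$, $\tau\ge1$, $y,y^\delta\in Y$ with $\|y-y^\delta\|_Y\le\delta$. Let $x^\dagger\ne0$ be a sparse $\mathcal{R}_\eta$-minimum solution of $Ax=y$ such that for every $i\in\mathcal{I}(x^\dagger)$ there exists $\omega_i\in Y$ with $e_i=A^*\omega_i$. Let $x_{\alpha,\beta}^\delta$ be a minimizer over $\ell_2$ of $\frac1q\|Ax-y^\delta\|_Y^q+\mathcal{R}_{\alpha,\beta}(x)$, where the parameters $\alpha,\beta$ are determined via the discrepancy principle $$\delta\le\|Ax_{\alpha,\beta}^\delta-y^\delta\|_Y\le\tau\delta .$$ Let $M>0$ be a constant with $\mathcal{R}_{\alpha,\beta}(x_{\alpha,\beta}^\delta)\le M$, and let $c_1>c_2$ with $c_1>0$, and $c_3>0$, be constants such that for every $x\in\ell_2$ with $\mathcal{R}_{\alpha,\beta}(x)\le M$, $$c_3(\alpha-\beta)\|x-x^\dagger\|_{\ell_1}\le \mathcal{R}_{\alpha,\beta}(x)-\mathcal{R}_{\alpha,\beta}(x^\dagger)+(c_1\alpha-c_2\beta)\|Ax-Ax^\dagger\|_Y .$$ Then $$\|x_{\alpha,\beta}^\delta-x^\dagger\|_{\ell_2}\le\frac{(c_1-c_2\eta)(\tau+1)\delta}{c_3(1-\eta)} .$$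
   Context: $\ell_2$ is the real Hilbert space of square-summable sequences indexed by $\mathbb{N}$, $Y$ is a Hilbert space, and $A:\ell_2\to Y$ is a bounded linear operator with adjoint $A^*$. $e_i$ is the $i$th standard unit sequence. $\mathcal{R}_{\alpha,\beta}(x)=\alpha\|x\|_{\ell_1}^2-\beta\|x\|_{\ell_2}^2$ and $\mathcal{R}_\eta(x)=\|x\|_{\ell_1}^2-\eta\|x\|_{\ell_2}^2$, with value $+\infty$ if $x\notin\ell_1$. An $\mathcal{R}_\eta$-minimum solution of $Ax=y$ is an element $x^\dagger\in\ell_2$ with $Ax^\dagger=y$ and $\mathcal{R}_\eta(x^\dagger)=\min\{\mathcal{R}_\eta(x): x\in\ell_2,\ Ax=y\}$. $\mathcal{I}(x^\dagger)=\{i\in\mathbb{N}: x_i^\dagger\ne0\}$, and sparse means that $\mathcal{I}(x^\dagger)$ is finite. *)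

theory Defs
  imports "HOL-Analysis.Analysis"
begin

section \<open>The real Hilbert space of square-summable sequences\<close>

typedef ell2 = "{x :: nat \<Rightarrow> real. summable (\<lambda>i. (x i)\<^sup>2)}"
  morphisms coord Abs_ell2
  by (rule exI[of _ "\<lambda>_. 0"]) simp

setup_lifting type_definition_ell2

lemma summable_coord_square: "summable (\<lambda>i. (coord x i)\<^sup>2)"
  using coord[of x] by simp

lemma ell2_eqI: "(\<And>i. coord x i = coord y i) \<Longrightarrow> x = y"
  by (simp add: coord_inject[symmetric] fun_eq_iff)

lemma summable_mult_square_summable:
  fixes f g :: "nat \<Rightarrow> real"
  assumes "summable (\<lambda>i. (f i)\<^sup>2)" "summable (\<lambda>i. (g i)\<^sup>2)"
  shows "summable (\<lambda>i. f i * g i)"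
proof (rule summable_comparison_test')
  show "summable (\<lambda>i. (f i)\<^sup>2 + (g i)\<^sup>2)"
    by (intro summable_add assms)
  show "norm (f n * g n) \<le> (f n)\<^sup>2 + (g n)\<^sup>2" if "n \<ge> 0" for n
  proof -
    have "2 * (\<bar>f n\<bar> * \<bar>g n\<bar>) \<le> (f n)\<^sup>2 + (g n)\<^sup>2"
      using sum_squares_bound[of "\<bar>f n\<bar>" "\<bar>g n\<bar>"] by simp
    moreover have "0 \<le> \<bar>f n\<bar> * \<bar>g n\<bar>" by simp
    ultimately have "\<bar>f n\<bar> * \<bar>g n\<bar> \<le> (f n)\<^sup>2 + (g n)\<^sup>2" by linarith
    then show ?thesis by (simp add: abs_mult)
  qed
qed

lemma square_summable_add:
  fixes f g :: "nat \<Rightarrow> real"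
  assumes "summable (\<lambda>i. (f i)\<^sup>2)" "summable (\<lambda>i. (g i)\<^sup>2)"
  shows "summable (\<lambda>i. (f i + g i)\<^sup>2)"
proof -
  have "summable (\<lambda>i. (f i)\<^sup>2 + (g i)\<^sup>2 + 2 * (f i * g i))"
    by (intro summable_add summable_mult summable_mult_square_summable assms)
  then show ?thesis by (simp add: power2_sum mult.assoc)
qed

instantiation ell2 :: real_vector
begin

lift_definition zero_ell2 :: ell2 is "\<lambda>_. 0" by simp

lift_definition plus_ell2 :: "ell2 \<Rightarrow> ell2 \<Rightarrow> ell2" is "\<lambda>x y i. x i + y i"
  by (rule square_summable_add)

lift_definition uminus_ell2 :: "ell2 \<Rightarrow> ell2" is "\<lambda>x i. - x i" by simp

lift_definition minus_ell2 :: "ell2 \<Rightarrow> ell2 \<Rightarrow> ell2" is "\<lambda>x y i. x i - y i"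
  subgoal for x y using square_summable_add[of x "\<lambda>i. - y i"] by simp
  done

lift_definition scaleR_ell2 :: "real \<Rightarrow> ell2 \<Rightarrow> ell2" is "\<lambda>r x i. r * x i"
  by (simp add: power_mult_distrib summable_mult)

instance
  by standard (transfer; simp add: algebra_simps fun_eq_iff)+

end

instantiation ell2 :: real_inner
begin

definition inner_ell2 :: "ell2 \<Rightarrow> ell2 \<Rightarrow> real"
  where "inner_ell2 x y = (\<Sum>i. coord x i * coord y i)"

definition norm_ell2 :: "ell2 \<Rightarrow> real"
  where "norm_ell2 x = sqrt (\<Sum>i. (coord x i)\<^sup>2)"

definition sgn_ell2 :: "ell2 \<Rightarrow> ell2"
  where "sgn_ell2 x = x /\<^sub>R norm x"

definition dist_ell2 :: "ell2 \<Rightarrow> ell2 \<Rightarrow> real"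
  where "dist_ell2 x y = norm (x - y)"

definition uniformity_ell2 :: "(ell2 \<times> ell2) filter"
  where "uniformity_ell2 = (INF e\<in>{0<..}. principal {(x, y). dist x y < e})"

definition open_ell2 :: "ell2 set \<Rightarrow> bool"
  where "open_ell2 U = (\<forall>x\<in>U. \<forall>\<^sub>F (x', y) in uniformity. x' = x \<longrightarrow> y \<in> U)"

instance
proof
  fix x y z :: ell2 and r :: real
  have s: "summable (\<lambda>i. coord u i * coord v i)" for u v
    by (intro summable_mult_square_summable summable_coord_square)
  show "inner x y = inner y x"
    by (simp add: inner_ell2_def mult.commute)
  show "inner (x + y) z = inner x z + inner y z"
    by (simp add: inner_ell2_def plus_ell2.rep_eq distrib_right suminf_add[OF s s])
  show "inner (r *\<^sub>R x) y = r * inner x y"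
    by (simp add: inner_ell2_def scaleR_ell2.rep_eq mult.assoc suminf_mult[OF s])
  show "0 \<le> inner x x"
    unfolding inner_ell2_def by (intro suminf_nonneg s) simp
  show "inner x x = 0 \<longleftrightarrow> x = 0"
  proof
    assume "inner x x = 0"
    then have "\<forall>i. coord x i * coord x i = 0"
      unfolding inner_ell2_def using suminf_eq_zero_iff[OF s[of x x]] by simp
    then show "x = 0" by (intro ell2_eqI) (simp add: zero_ell2.rep_eq)
  qed (simp add: inner_ell2_def zero_ell2.rep_eq)
  show "norm x = sqrt (inner x x)"
    by (simp add: norm_ell2_def inner_ell2_def power2_eq_square)
qed (simp_all add: sgn_ell2_def dist_ell2_def uniformity_ell2_def open_ell2_def)

end

lemma sum_coord_square_le:
  "(\<Sum>i<n. (coord x i)\<^sup>2) \<le> (norm x)\<^sup>2"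
proof -
  have "(\<Sum>i<n. (coord x i)\<^sup>2) \<le> (\<Sum>i. (coord x i)\<^sup>2)"
    by (intro sum_le_suminf summable_coord_square) auto
  then show ?thesis
    by (simp add: norm_ell2_def suminf_nonneg summable_coord_square)
qed

lemma abs_coord_le_norm: "\<bar>coord x i\<bar> \<le> norm x"
proof -
  have "(coord x i)\<^sup>2 \<le> (\<Sum>j<Suc i. (coord x j)\<^sup>2)"
    by (simp add: sum_nonneg)
  also have "\<dots> \<le> (norm x)\<^sup>2" by (rule sum_coord_square_le)
  finally show ?thesis by (simp add: abs_le_square_iff[symmetric])
qed

lemma square_summable_if_bounded:
  fixes f :: "nat \<Rightarrow> real"
  assumes "\<And>n. (\<Sum>i<n. (f i)\<^sup>2) \<le> C"
  shows "summable (\<lambda>i. (f i)\<^sup>2)" "(\<Sum>i. (f i)\<^sup>2) \<le> C"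
proof -
  show s: "summable (\<lambda>i. (f i)\<^sup>2)"
    by (rule summableI_nonneg_bounded[of _ C]) (use assms in auto)
  show "(\<Sum>i. (f i)\<^sup>2) \<le> C"
    using s assms by (rule suminf_le_const)
qed

instance ell2 :: complete_space
proof
  fix X :: "nat \<Rightarrow> ell2"
  assume X: "Cauchy X"
  have "Cauchy (\<lambda>n. coord (X n) i)" for i
  proof (rule metric_CauchyI)
    fix e :: real assume "0 < e"
    then obtain N where N: "\<And>m n. m \<ge> N \<Longrightarrow> n \<ge> N \<Longrightarrow> dist (X m) (X n) < e"
      using X unfolding Cauchy_def by blast
    have "dist (coord (X m) i) (coord (X n) i) \<le> dist (X m) (X n)" for m n
      using abs_coord_le_norm[of "X m - X n" i]
      by (simp add: dist_norm minus_ell2.rep_eq)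
    then show "\<exists>N. \<forall>m\<ge>N. \<forall>n\<ge>N. dist (coord (X m) i) (coord (X n) i) < e"
      using N by (meson le_less_trans)
  qed
  then have "\<exists>l. (\<lambda>n. coord (X n) i) \<longlonglongrightarrow> l" for i
    by (simp add: Cauchy_convergent_iff convergent_def)
  then obtain l where l: "\<And>i. (\<lambda>n. coord (X n) i) \<longlonglongrightarrow> l i" by metis
  have bd: "\<exists>N. \<forall>m\<ge>N. \<forall>k. (\<Sum>i<k. (l i - coord (X m) i)\<^sup>2) \<le> e\<^sup>2" if "0 < e" for e :: real
  proof -
    obtain N where N: "\<And>m n. m \<ge> N \<Longrightarrow> n \<ge> N \<Longrightarrow> dist (X m) (X n) < e"
      using X \<open>0 < e\<close> unfolding Cauchy_def by blast
    have "(\<Sum>i<k. (l i - coord (X m) i)\<^sup>2) \<le> e\<^sup>2" if "m \<ge> N" for m k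
    proof (rule LIMSEQ_le_const2)
      show "(\<lambda>n. \<Sum>i<k. (coord (X n) i - coord (X m) i)\<^sup>2) \<longlonglongrightarrow> (\<Sum>i<k. (l i - coord (X m) i)\<^sup>2)"
        by (intro tendsto_intros l)
      have "(\<Sum>i<k. (coord (X n) i - coord (X m) i)\<^sup>2) \<le> e\<^sup>2" if "n \<ge> N" for n
      proof -
        have "(\<Sum>i<k. (coord (X n) i - coord (X m) i)\<^sup>2) \<le> (norm (X n - X m))\<^sup>2"
          using sum_coord_square_le[of "X n - X m" k] by (simp add: minus_ell2.rep_eq)
        also have "\<dots> \<le> e\<^sup>2"
          using N[OF \<open>n \<ge> N\<close> \<open>m \<ge> N\<close>] by (intro power_mono) (auto simp: dist_norm)
        finally show ?thesis .
      qed
      then show "\<exists>N. \<forall>n\<ge>N. (\<Sum>i<k. (coord (X n) i - coord (X m) i)\<^sup>2) \<le> e\<^sup>2"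
        by blast
    qed
    then show ?thesis by blast
  qed
  obtain N1 where "\<And>k. (\<Sum>i<k. (l i - coord (X N1) i)\<^sup>2) \<le> 1\<^sup>2"
    using bd[of 1] by auto
  then have "summable (\<lambda>i. (l i - coord (X N1) i)\<^sup>2)"
    by (rule square_summable_if_bounded(1))
  then have "summable (\<lambda>i. (l i)\<^sup>2)"
    using square_summable_add[OF _ summable_coord_square[of "X N1"]] by fastforce
  then obtain L where L: "\<And>i. coord L i = l i"
    using Abs_ell2_inverse[of l] by (metis mem_Collect_eq)
  have "X \<longlonglongrightarrow> L"
  proof (rule metric_LIMSEQ_I)
    fix e :: real assume e: "0 < e"
    obtain N where N: "\<And>m k. m \<ge> N \<Longrightarrow> (\<Sum>i<k. (l i - coord (X m) i)\<^sup>2) \<le> (e / 2)\<^sup>2"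
      using bd[of "e / 2"] e by auto
    have "dist (X m) L < e" if "m \<ge> N" for m
    proof -
      have "norm (L - X m) \<le> sqrt ((e / 2)\<^sup>2)"
        unfolding norm_ell2_def minus_ell2.rep_eq L
        using square_summable_if_bounded(2)[OF N[OF that]] by (rule real_sqrt_le_mono)
      then show ?thesis using e by (simp add: dist_norm norm_minus_commute)
    qed
    then show "\<exists>N. \<forall>m\<ge>N. dist (X m) L < e" by blast
  qed
  then show "convergent X" by (auto simp: convergent_def)
qed

lift_definition unit_seq :: "nat \<Rightarrow> ell2" is "\<lambda>i j. if j = i then 1 else 0"
  by (rule summable_finite[of "{i}" for i]) auto

lemma inner_unit_seq: "inner x (unit_seq i) = coord x i"
proof -
  have "(\<lambda>j. coord x j * coord (unit_seq i) j) = (\<lambda>j. if j = i then coord x j else 0)"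
    by (auto simp: unit_seq.rep_eq)
  then show ?thesis
    unfolding inner_ell2_def using sums_single[of i "coord x"] by (simp add: sums_iff)
qed

subsection \<open>Adjoints of bounded operators on the sequence space\<close>

text \<open>
  The library constant \<^const>\<open>adjoint\<close> is defined by Hilbert choice and \<^theory>\<open>HOL-Analysis.Linear_Algebra\<close>
  only shows its existence for Euclidean domains. The following facts show that on \<^typ>\<open>ell2\<close> it
  is the Hilbert space adjoint.
\<close>

lemma coord_sum: "coord (\<Sum>j\<in>S. f j) i = (\<Sum>j\<in>S. coord (f j) i)"
  by (induction S rule: infinite_finite_induct) (auto simp: zero_ell2.rep_eq plus_ell2.rep_eq)

lemma coord_truncation:
  "coord (\<Sum>j<n. a j *\<^sub>R unit_seq j) i = (if i < n then a i else 0)"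
  by (simp add: coord_sum scaleR_ell2.rep_eq unit_seq.rep_eq if_distrib cong: if_cong)

lemma sums_unit_seq: "(\<lambda>j. coord x j *\<^sub>R unit_seq j) sums x"
proof -
  have eq: "norm (x - (\<Sum>j<n. coord x j *\<^sub>R unit_seq j)) = sqrt (\<Sum>i. (coord x (i + n))\<^sup>2)" for n
  proof -
    let ?g = "\<lambda>i. (coord (x - (\<Sum>j<n. coord x j *\<^sub>R unit_seq j)) i)\<^sup>2"
    have "suminf ?g = (\<Sum>i. ?g (i + n)) + (\<Sum>i<n. ?g i)"
      by (rule suminf_split_initial_segment) (rule summable_coord_square)
    also have "\<dots> = (\<Sum>i. (coord x (i + n))\<^sup>2)"
      by (simp add: minus_ell2.rep_eq coord_truncation)
    finally show ?thesis by (simp add: norm_ell2_def)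
  qed
  have "(\<lambda>n. sqrt (\<Sum>i. (coord x (i + n))\<^sup>2)) \<longlonglongrightarrow> sqrt 0"
    by (intro tendsto_real_sqrt suminf_exist_split2 summable_coord_square)
  then have "(\<lambda>n. norm ((\<Sum>j<n. coord x j *\<^sub>R unit_seq j) - x)) \<longlonglongrightarrow> 0"
    by (subst norm_minus_commute) (simp add: eq)
  then show ?thesis
    unfolding sums_def using LIM_zero_cancel tendsto_norm_zero_iff by blast
qed

lemma adjoint_exists_ell2:
  fixes A :: "ell2 \<Rightarrow> 'y::real_inner"
  assumes "bounded_linear A"
  shows "\<exists>B. \<forall>x w. inner (A x) w = inner x (B w)"
proof -
  interpret A: bounded_linear A by fact
  have "\<exists>b. \<forall>x. inner (A x) w = inner x b" for w
  proof -
    let ?a = "\<lambda>i. inner (A (unit_seq i)) w"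
    have "(\<Sum>i<n. (?a i)\<^sup>2) \<le> (onorm A * norm w)\<^sup>2" for n
    proof -
      define v where "v = (\<Sum>j<n. ?a j *\<^sub>R unit_seq j)"
      have v: "inner (A v) w = (\<Sum>i<n. (?a i)\<^sup>2)"
        by (simp add: v_def A.sum A.scaleR inner_sum_left power2_eq_square)
      have "(\<Sum>i. (coord v i)\<^sup>2) = (\<Sum>i<n. (coord v i)\<^sup>2)"
        by (rule suminf_finite) (auto simp: v_def coord_truncation)
      then have nv: "(norm v)\<^sup>2 = (\<Sum>i<n. (?a i)\<^sup>2)"
        by (simp add: norm_ell2_def sum_nonneg v_def coord_truncation)
      have "(norm v)\<^sup>2 \<le> norm (A v) * norm w"
        unfolding nv using v norm_cauchy_schwarz[of "A v" w] by simp
      also have "\<dots> \<le> (onorm A * norm v) * norm w"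
        by (intro mult_right_mono onorm assms) simp
      finally have "norm v * norm v \<le> norm v * (onorm A * norm w)"
        by (simp add: power2_eq_square mult_ac)
      then have "norm v \<le> onorm A * norm w"
        by (cases "norm v = 0") (use onorm_pos_le[OF assms] in \<open>auto simp: mult_le_cancel_left\<close>)
      then show ?thesis unfolding nv[symmetric] by (intro power_mono) auto
    qed
    then have "summable (\<lambda>i. (?a i)\<^sup>2)" by (rule square_summable_if_bounded(1))
    then obtain b where b: "\<And>i. coord b i = ?a i"
      using Abs_ell2_inverse[of ?a] by (metis mem_Collect_eq)
    have "inner (A x) w = inner x b" for x
    proof -
      have bl: "bounded_linear (\<lambda>x. inner (A x) w)"
        by (rule bounded_linear_compose[OF bounded_linear_inner_left assms])
      have "(\<lambda>j. inner (A (coord x j *\<^sub>R unit_seq j)) w) sums inner (A x) w"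
        by (rule bounded_linear.sums[OF bl sums_unit_seq])
      then have "(\<lambda>j. coord x j * coord b j) sums inner (A x) w"
        by (simp add: A.scaleR b)
      then show ?thesis by (simp add: inner_ell2_def sums_iff)
    qed
    then show ?thesis by blast
  qed
  then show ?thesis by metis
qed

lemma adjoint_ell2:
  fixes A :: "ell2 \<Rightarrow> 'y::real_inner"
  assumes "bounded_linear A"
  shows "inner (A x) w = inner x (adjoint A w)"
  unfolding adjoint_def using someI_ex[OF adjoint_exists_ell2[OF assms]] by blast


section \<open>Regularization functionals, minimum solutions and sparsity\<close>

text \<open>
  Real-valued, so meaningful only on absolutely summable sequences; off these \<^const>\<open>suminf\<close>
  is unspecified.
\<close>
definition ell1_norm :: "ell2 \<Rightarrow> real"
  where "ell1_norm x = (\<Sum>i. \<bar>coord x i\<bar>)"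

definition ell1 :: "ell2 set"
  where "ell1 = {x. summable (\<lambda>i. \<bar>coord x i\<bar>)}"

definition reg :: "real \<Rightarrow> real \<Rightarrow> ell2 \<Rightarrow> ereal"
  where "reg \<alpha> \<beta> x =
    (if x \<in> ell1 then ereal (\<alpha> * (ell1_norm x)\<^sup>2 - \<beta> * (norm x)\<^sup>2) else \<infinity>)"

definition reg_eta :: "real \<Rightarrow> ell2 \<Rightarrow> ereal"
  where "reg_eta \<eta> x =
    (if x \<in> ell1 then ereal ((ell1_norm x)\<^sup>2 - \<eta> * (norm x)\<^sup>2) else \<infinity>)"

definition minimum_solution :: "real \<Rightarrow> (ell2 \<Rightarrow> 'y) \<Rightarrow> 'y \<Rightarrow> ell2 \<Rightarrow> bool"
  where "minimum_solution \<eta> A y x \<longleftrightarrow> is_arg_min (reg_eta \<eta>) (\<lambda>z. A z = y) x"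

definition supp :: "ell2 \<Rightarrow> nat set"
  where "supp x = {i. coord x i \<noteq> 0}"

definition sparse_seq :: "ell2 \<Rightarrow> bool"
  where "sparse_seq x \<longleftrightarrow> finite (supp x)"

text \<open>
  The exponent is real, hence \<^const>\<open>powr\<close>; for \<open>q > 0\<close> its convention
  \<open>0 powr q = 0\<close> agrees with the usual power.
\<close>
definition tikhonov ::
    "real \<Rightarrow> real \<Rightarrow> real \<Rightarrow> (ell2 \<Rightarrow> 'y::real_normed_vector) \<Rightarrow> 'y \<Rightarrow> ell2 \<Rightarrow> ereal"
  where "tikhonov q \<alpha> \<beta> A z x = ereal (1 / q * norm (A x - z) powr q) + reg \<alpha> \<beta> x"

end

theory Submission
  imports Defs
begin

text \<open>
  The lower discrepancy bound is what makes the estimate work. The data misfit of the exact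
  solution is at most \<open>\<delta>\<close>, while that of the minimizer is at least \<open>\<delta>\<close>. Since its
  Tikhonov value is no larger, neither is its penalty (\<open>penalty_le_if_misfit_ge\<close>). The penalty
  difference in the assumed inequality is therefore nonpositive, and what remains bounds the \<open>\<ell>\<^sub>1\<close> distance by the residual
  \<open>\<parallel>Ax\<^sup>\<delta> - y\<parallel>\<close>, which is at most \<open>(\<tau> + 1)\<delta>\<close> by the triangle inequality and the upper
  discrepancy bound. The \<open>\<ell>\<^sub>2\<close> norm is dominated by the \<open>\<ell>\<^sub>1\<close> norm (\<open>norm_le_ell1_norm\<close>), and a
  factor \<open>\<alpha>\<close> cancels because \<open>\<beta> = \<eta>\<alpha>\<close>.
\<close>

lemma sparse_seq_in_ell1:
  assumes "sparse_seq x"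
  shows "x \<in> ell1"
proof -
  have "summable (\<lambda>i. \<bar>coord x i\<bar>)"
    using assms unfolding sparse_seq_def by (rule summable_finite) (simp add: supp_def)
  then show ?thesis by (simp add: ell1_def)
qed

lemma ell1_diff:
  assumes "x \<in> ell1" and "z \<in> ell1"
  shows "x - z \<in> ell1"
proof -
  have "summable (\<lambda>i. \<bar>coord x i\<bar> + \<bar>coord z i\<bar>)"
    using assms unfolding ell1_def by (intro summable_add) simp_all
  then have "summable (\<lambda>i. \<bar>coord (x - z) i\<bar>)"
    by (rule summable_comparison_test'[where N = 0]) (simp add: minus_ell2.rep_eq)
  then show ?thesis by (simp add: ell1_def)
qed

lemma norm_le_ell1_norm:
  assumes "x \<in> ell1"
  shows "norm x \<le> ell1_norm x"
proof -
  have s: "summable (\<lambda>i. \<bar>coord x i\<bar>)" using assms by (simp add: ell1_def)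
  have nonneg: "0 \<le> ell1_norm x"
    unfolding ell1_norm_def using s by (rule suminf_nonneg) simp
  have "(\<Sum>i<n. (coord x i)\<^sup>2) \<le> (ell1_norm x)\<^sup>2" for n
  proof -
    have "L2_set (coord x) {..<n} \<le> (\<Sum>i<n. \<bar>coord x i\<bar>)"
      by (rule L2_set_le_sum_abs)
    also have "\<dots> \<le> ell1_norm x"
      unfolding ell1_norm_def using s by (intro sum_le_suminf) auto
    finally show ?thesis
      unfolding L2_set_def by (rule sqrt_le_D)
  qed
  then have "(\<Sum>i. (coord x i)\<^sup>2) \<le> (ell1_norm x)\<^sup>2"
    by (rule square_summable_if_bounded(2))
  then show ?thesis
    unfolding norm_ell2_def using nonneg by (rule real_le_lsqrt[rotated])
qed

text \<open>
  Comparing Tikhonov values trades misfit against penalty: a minimizer that fits the data no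
  better than \<open>z\<close> can only be optimal by having a penalty no larger than that of \<open>z\<close>.
\<close>
lemma penalty_le_if_misfit_ge:
  assumes "is_arg_min (tikhonov q \<alpha> \<beta> A d) (\<lambda>_. True) x"
    and "0 < q" and "norm (A z - d) \<le> norm (A x - d)"
  shows "reg \<alpha> \<beta> x \<le> reg \<alpha> \<beta> z"
proof -
  define s where "s = 1 / q * norm (A x - d) powr q"
  define t where "t = 1 / q * norm (A z - d) powr q"
  have "t \<le> s"
    unfolding s_def t_def using assms(2,3) by (intro mult_left_mono powr_mono2) auto
  have "ereal s + reg \<alpha> \<beta> x \<le> ereal t + reg \<alpha> \<beta> z"
    using assms(1) by (auto simp: is_arg_min_def tikhonov_def s_def t_def not_less)
  also have "\<dots> \<le> ereal s + reg \<alpha> \<beta> z"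
    using \<open>t \<le> s\<close> by (intro add_right_mono) simp
  finally show ?thesis by (simp add: ereal_add_le_add_iff)
qed

theorem theorem3p10:
  fixes A :: "ell2 \<Rightarrow> 'y::{real_inner, complete_space}"
    and y y\<delta> :: 'y
    and xdag x\<delta> :: ell2
    and q \<alpha> \<beta> \<eta> \<delta> \<tau> M c1 c2 c3 :: real
  assumes "bounded_linear A"
    and "1 \<le> q" and "q \<le> 2"
    and "\<alpha> > \<beta>" and "\<beta> > 0" and "\<beta> = \<eta> * \<alpha>"
    and "\<delta> > 0" and "\<tau> \<ge> 1"
    and "norm (y - y\<delta>) \<le> \<delta>"
    and "xdag \<noteq> 0" and "sparse_seq xdag"
    and "minimum_solution \<eta> A y xdag"
    and "\<forall>i\<in>supp xdag. \<exists>\<omega>. unit_seq i = adjoint A \<omega>"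
    and "is_arg_min (tikhonov q \<alpha> \<beta> A y\<delta>) (\<lambda>_. True) x\<delta>"
    and "\<delta> \<le> norm (A x\<delta> - y\<delta>)" and "norm (A x\<delta> - y\<delta>) \<le> \<tau> * \<delta>"
    and "M > 0" and "reg \<alpha> \<beta> x\<delta> \<le> ereal M"
    and "c1 > c2" and "c1 > 0" and "c3 > 0"
    and "\<forall>x. reg \<alpha> \<beta> x \<le> ereal M \<longrightarrow>
           ereal (c3 * (\<alpha> - \<beta>) * ell1_norm (x - xdag))
             \<le> reg \<alpha> \<beta> x - reg \<alpha> \<beta> xdag
               + ereal ((c1 * \<alpha> - c2 * \<beta>) * norm (A x - A xdag))"
  shows "norm (x\<delta> - xdag) \<le> (c1 - c2 * \<eta>) * (\<tau> + 1) * \<delta> / (c3 * (1 - \<eta>))"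
proof -
  have \<alpha>: "0 < \<alpha>" using \<open>\<alpha> > \<beta>\<close> \<open>\<beta> > 0\<close> by simp
  have exact: "A xdag = y"
    using \<open>minimum_solution \<eta> A y xdag\<close> by (simp add: minimum_solution_def is_arg_min_def)
  have xdag: "xdag \<in> ell1" using \<open>sparse_seq xdag\<close> by (rule sparse_seq_in_ell1)
  have x\<delta>: "x\<delta> \<in> ell1" using \<open>reg \<alpha> \<beta> x\<delta> \<le> ereal M\<close> by (auto simp: reg_def split: if_splits)
  have "norm (A xdag - y\<delta>) \<le> norm (A x\<delta> - y\<delta>)"
    using \<open>norm (y - y\<delta>) \<le> \<delta>\<close> \<open>\<delta> \<le> norm (A x\<delta> - y\<delta>)\<close> by (simp add: exact)
  then have penalty: "reg \<alpha> \<beta> x\<delta> \<le> reg \<alpha> \<beta> xdag"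
    using \<open>is_arg_min (tikhonov q \<alpha> \<beta> A y\<delta>) (\<lambda>_. True) x\<delta>\<close> \<open>1 \<le> q\<close>
    by (intro penalty_le_if_misfit_ge) auto
  have "ereal (c3 * (\<alpha> - \<beta>) * ell1_norm (x\<delta> - xdag))
      \<le> reg \<alpha> \<beta> x\<delta> - reg \<alpha> \<beta> xdag + ereal ((c1 * \<alpha> - c2 * \<beta>) * norm (A x\<delta> - A xdag))"
    using assms(22) \<open>reg \<alpha> \<beta> x\<delta> \<le> ereal M\<close> by blast
  then have ell1_bound:
    "c3 * (\<alpha> - \<beta>) * ell1_norm (x\<delta> - xdag) \<le> (c1 * \<alpha> - c2 * \<beta>) * norm (A x\<delta> - A xdag)"
    using penalty x\<delta> xdag by (simp add: reg_def)
  have residual: "norm (A x\<delta> - A xdag) \<le> (\<tau> + 1) * \<delta>"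
  proof -
    have "norm (A x\<delta> - A xdag) \<le> norm (A x\<delta> - y\<delta>) + norm (y - y\<delta>)"
      using norm_triangle_ineq4[of "A x\<delta> - y\<delta>" "y - y\<delta>"] by (simp add: exact)
    also have "\<dots> \<le> \<tau> * \<delta> + \<delta>"
      using \<open>norm (A x\<delta> - y\<delta>) \<le> \<tau> * \<delta>\<close> \<open>norm (y - y\<delta>) \<le> \<delta>\<close> by simp
    finally show ?thesis by (simp add: algebra_simps)
  qed
  \<comment> \<open>Passing through \<open>c1 * \<beta>\<close> covers negative \<open>c2\<close>, where \<open>c2 * \<beta> \<le> c2 * \<alpha>\<close> would fail.\<close>
  have "c2 * \<beta> \<le> c1 * \<beta>" using \<open>c1 > c2\<close> \<open>\<beta> > 0\<close> by simp
  also have "\<dots> \<le> c1 * \<alpha>" using \<open>c1 > 0\<close> \<open>\<alpha> > \<beta>\<close> by simp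
  finally have coeff: "0 \<le> c1 * \<alpha> - c2 * \<beta>" by simp
  have "c3 * (\<alpha> - \<beta>) * norm (x\<delta> - xdag) \<le> c3 * (\<alpha> - \<beta>) * ell1_norm (x\<delta> - xdag)"
    using \<open>c3 > 0\<close> \<open>\<alpha> > \<beta>\<close> by (intro mult_left_mono norm_le_ell1_norm ell1_diff x\<delta> xdag) simp
  also note ell1_bound
  also have "(c1 * \<alpha> - c2 * \<beta>) * norm (A x\<delta> - A xdag) \<le> (c1 * \<alpha> - c2 * \<beta>) * ((\<tau> + 1) * \<delta>)"
    using residual coeff by (rule mult_left_mono)
  finally have "\<alpha> * (norm (x\<delta> - xdag) * (c3 * (1 - \<eta>))) \<le> \<alpha> * ((c1 - c2 * \<eta>) * (\<tau> + 1) * \<delta>)"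
    unfolding \<open>\<beta> = \<eta> * \<alpha>\<close> by (simp add: algebra_simps)
  then have "norm (x\<delta> - xdag) * (c3 * (1 - \<eta>)) \<le> (c1 - c2 * \<eta>) * (\<tau> + 1) * \<delta>"
    using \<alpha> by (rule mult_left_le_imp_le)
  moreover have "0 < c3 * (1 - \<eta>)"
    using \<open>c3 > 0\<close> \<open>\<alpha> > \<beta>\<close> \<alpha> unfolding \<open>\<beta> = \<eta> * \<alpha>\<close> by simp
  ultimately show ?thesis by (simp add: pos_le_divide_eq)
qed

end
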